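(* Let $(M,\mathcal T,I)$ be a triangulated closed surface with inversive distance $I\ge 0$. Suppose $\{r(t)\mid t\in[0,T)\}$, with $0<T\le+\infty$, is the unique maximal solution in $\Omega$ of the normalized flow $$r_i'(t)=(K_{av}-K_i)\,r_i,\quad i\in V,\qquad r(0)\in\Omega .$$ Then, when $T<+\infty$, it can always be extended to a solution $\{r(t)\mid t\in[0,+\infty)\}$ of the extended flow in $\mathbb R^N_{>0}$; equivalently, writing $u_i=\ln r_i$, the solution to the extended flow $$u_i'(t)=K_{av}-\widetilde K_i,\quad i\in V,\qquad u(0)=(\ln r_1(0),\dots,\ln r_N(0))^T\in\ln\Omega,$$ exists for all time $t\in[0,+\infty)$.
   Context: $M$ is a closed surface with triangulation $\mathcal T=\{V,E,F\}$ (vertices, edges, faces), $V=\{1,\dots,N\}$; $\{ij\}$ denotes the edge joining $i,j$ and $\{ijk\}$ the face with vertices $i,j,k$. The inversive distance is a fixed function $I:E\to[0,+\infty)$. For $r\in\mathbb R^N_{>0}$ put $l_{ij}=\sqrt{r_i^2+r_j^2+2r_ir_jI_{ij}}$ for each edge. $\Omega\subset\mathbb R^N_{>0}$ is the set of $r$ such that for every face $\{ijk\}$ the three numbers $l_{ij},l_{jk},l_{ik}$ satisfy the three strict triangle inequalities; elements of $\Omega$ are called inversive distance circle packing metrics. $\ln\Omega=\{x\in\mathbb R^N: (e^{x_1},\dots,e^{x_N})\in\Omega\}$. For $r\in\Omega$, $\theta_i^{jk}$ is the inner angle at $i$ of the Euclidean triangle with edge lengths $l_{ij},l_{jk},l_{ik}$,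 and $K_i=2\pi-\sum_{\{ijk\}\in F}\theta_i^{jk}$ (sum over faces containing $i$). $K_{av}=2\pi\chi(M)/N$. For arbitrary $r\in\mathbb R^N_{>0}$ and a face $\{ijk\}$, the generalized angles are defined by: if the strict triangle inequalities hold, $\tilde\theta_i^{jk}=\theta_i^{jk}$ (and similarly for $j,k$); if $l_{jk}\ge l_{ij}+l_{ik}$, then $\tilde\theta_i^{jk}=\pi$ and $\tilde\theta_j^{ik}=\tilde\theta_k^{ij}=0$ (and similarly with the roles of $i,j,k$ permuted). The extended curvature is $\widetilde K_i=2\pi-\sum_{\{ijk\}\in F}\tilde\theta_i^{jk}$, a continuous function on $\mathbb R^N_{>0}$ extending $K_i$; as a function of $u$ it is evaluated at $r=(e^{u_1},\dots,e^{u_N})$. The extended flow in $r$-coordinates is $r_i'=(K_{av}-\widetilde K_i)r_i$. *)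

theory Defs
  imports "HOL-Analysis.Analysis"
begin

text \<open>
  The vertex set is a finite type \<^typ>\<open>'n\<close>, so that \<open>N = CARD('n)\<close> and \<open>\<real>\<^sup>N\<close> is \<open>real ^ 'n\<close>.
  Edges and faces are two- and three-element vertex sets.
\<close>

definition closed_surface :: "'m topology \<Rightarrow> bool" where
  "closed_surface M \<longleftrightarrow>
     topspace M \<noteq> {} \<and> compact_space M \<and> Hausdorff_space M \<and>
     (\<forall>p\<in>topspace M. \<exists>U. openin M U \<and> p \<in> U \<and>
        subtopology M U homeomorphic_space (euclidean :: (real ^ 2) topology))"

definition geometric_realization :: "'n::finite set set \<Rightarrow> 'n set set \<Rightarrow> (real ^ 'n) set" where
  "geometric_realization E F =
     (\<Union>\<sigma> \<in> range (\<lambda>i. {i}) \<union> E \<union> F. convex hull ((\<lambda>i. axis i 1) ` \<sigma>))"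

definition triangulation_of :: "'m topology \<Rightarrow> 'n::finite set set \<Rightarrow> 'n set set \<Rightarrow> bool" where
  "triangulation_of M E F \<longleftrightarrow>
     (\<forall>e\<in>E. card e = 2) \<and> (\<forall>f\<in>F. card f = 3) \<and>
     (\<forall>f\<in>F. \<forall>e. e \<subseteq> f \<and> card e = 2 \<longrightarrow> e \<in> E) \<and>
     M homeomorphic_space top_of_set (geometric_realization E F)"

definition euler_char :: "'n::finite set set \<Rightarrow> 'n set set \<Rightarrow> int" where
  "euler_char E F = int CARD('n) - int (card E) + int (card F)"

definition pos_orthant :: "(real ^ 'n::finite) set" where
  "pos_orthant = {r. \<forall>i. r $ i > 0}"

definition edge_length :: "('n::finite set \<Rightarrow> real) \<Rightarrow> real ^ 'n \<Rightarrow> 'n \<Rightarrow> 'n \<Rightarrow> real" where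
  "edge_length I r i j = sqrt ((r $ i)\<^sup>2 + (r $ j)\<^sup>2 + 2 * (r $ i) * (r $ j) * I {i, j})"

definition strict_triangle :: "real \<Rightarrow> real \<Rightarrow> real \<Rightarrow> bool" where
  "strict_triangle a b c \<longleftrightarrow> a < b + c \<and> b < a + c \<and> c < a + b"

definition Omega :: "'n::finite set set \<Rightarrow> ('n set \<Rightarrow> real) \<Rightarrow> (real ^ 'n) set" where
  "Omega F I = {r \<in> pos_orthant. \<forall>i j k. {i, j, k} \<in> F \<longrightarrow>
     strict_triangle (edge_length I r i j) (edge_length I r j k) (edge_length I r i k)}"

definition ln_vec :: "real ^ 'n \<Rightarrow> real ^ 'n::finite" where
  "ln_vec r = (\<chi> i. ln (r $ i))"

definition exp_vec :: "real ^ 'n \<Rightarrow> real ^ 'n::finite" where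
  "exp_vec u = (\<chi> i. exp (u $ i))"

definition ln_Omega :: "'n::finite set set \<Rightarrow> ('n set \<Rightarrow> real) \<Rightarrow> (real ^ 'n) set" where
  "ln_Omega F I = {x. exp_vec x \<in> Omega F I}"

text \<open>The angle at \<open>p\<close> between the segments \<open>pq\<close> and \<open>ps\<close>.\<close>

definition angle_at :: "real ^ 2 \<Rightarrow> real ^ 2 \<Rightarrow> real ^ 2 \<Rightarrow> real" where
  "angle_at p q s = arccos (((q - p) \<bullet> (s - p)) / (norm (q - p) * norm (s - p)))"

text \<open>
  The inner angle opposite the side of length \<open>a\<close> in a Euclidean triangle with side lengths
  \<open>a, b, c\<close>. It is meaningful only if the strict triangle inequalities hold; see
  \<open>triangle_angle_cos_law\<close> below.
\<close>

definition triangle_angle :: "real \<Rightarrow> real \<Rightarrow> real \<Rightarrow> real" where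
  "triangle_angle a b c = (THE \<theta>. \<exists>p q s. dist q s = a \<and> dist p q = b \<and> dist p s = c \<and>
     \<theta> = angle_at p q s)"

definition gen_triangle_angle :: "real \<Rightarrow> real \<Rightarrow> real \<Rightarrow> real" where
  "gen_triangle_angle a b c =
     (if strict_triangle a b c then triangle_angle a b c
      else if a \<ge> b + c then pi else 0)"

text \<open>
  The angle of the face \<open>f = {i, j, k}\<close> at \<open>i\<close>, for an angle function \<open>A\<close> whose first argument is
  the length of the opposite side. As \<open>A\<close> is symmetric in its last two arguments in both uses below,
  the order in which the remaining vertices \<open>j, k\<close> are chosen is irrelevant; see
  \<open>face_angle_eq\<close> below.
\<close>

definition face_angle ::
  "(real \<Rightarrow> real \<Rightarrow> real \<Rightarrow> real) \<Rightarrow> ('n::finite set \<Rightarrow> real) \<Rightarrow> real ^ 'n \<Rightarrow> 'n \<Rightarrow> 'n set \<Rightarrow> real" where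
  "face_angle A I r i f =
     (let (j, k) = (SOME (j, k). f = {i, j, k})
      in A (edge_length I r j k) (edge_length I r i j) (edge_length I r i k))"

definition curvature ::
  "'n::finite set set \<Rightarrow> ('n set \<Rightarrow> real) \<Rightarrow> real ^ 'n \<Rightarrow> 'n \<Rightarrow> real" where
  "curvature F I r i = 2 * pi - (\<Sum>f | f \<in> F \<and> i \<in> f. face_angle triangle_angle I r i f)"

definition ext_curvature ::
  "'n::finite set set \<Rightarrow> ('n set \<Rightarrow> real) \<Rightarrow> real ^ 'n \<Rightarrow> 'n \<Rightarrow> real" where
  "ext_curvature F I r i = 2 * pi - (\<Sum>f | f \<in> F \<and> i \<in> f. face_angle gen_triangle_angle I r i f)"

definition avg_curvature :: "'n::finite set set \<Rightarrow> 'n set set \<Rightarrow> real" where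
  "avg_curvature E F = 2 * pi * of_int (euler_char E F) / real CARD('n)"

definition time_interval :: "ereal \<Rightarrow> real set" where
  "time_interval T = {t. 0 \<le> t \<and> ereal t < T}"

text \<open>Solutions in \<open>X\<close> of \<open>x' = v x\<close> on \<open>[0,T)\<close>, with the one-sided derivative at \<open>0\<close>.\<close>

definition solution_in ::
  "(real ^ 'n::finite) set \<Rightarrow> (real ^ 'n \<Rightarrow> 'n \<Rightarrow> real) \<Rightarrow> ereal \<Rightarrow> (real \<Rightarrow> real ^ 'n) \<Rightarrow> bool" where
  "solution_in X v T x \<longleftrightarrow>
     (\<forall>t\<in>time_interval T. x t \<in> X \<and>
        (\<forall>i. ((\<lambda>s. x s $ i) has_real_derivative v (x t) i) (at t within time_interval T)))"

text \<open>
  A solution of which every other solution with the same initial value is a restriction; this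
  expresses both maximality and uniqueness.
\<close>

definition unique_maximal_solution_in ::
  "(real ^ 'n::finite) set \<Rightarrow> (real ^ 'n \<Rightarrow> 'n \<Rightarrow> real) \<Rightarrow> ereal \<Rightarrow> (real \<Rightarrow> real ^ 'n) \<Rightarrow> bool" where
  "unique_maximal_solution_in X v T x \<longleftrightarrow>
     solution_in X v T x \<and>
     (\<forall>S y. 0 < S \<and> solution_in X v S y \<and> y 0 = x 0 \<longrightarrow>
        S \<le> T \<and> (\<forall>t\<in>time_interval S. y t = x t))"

definition normalized_flow ::
  "'n::finite set set \<Rightarrow> 'n set set \<Rightarrow> ('n set \<Rightarrow> real) \<Rightarrow> real ^ 'n \<Rightarrow> 'n \<Rightarrow> real" where
  "normalized_flow E F I r i = (avg_curvature E F - curvature F I r i) * r $ i"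

definition ext_flow ::
  "'n::finite set set \<Rightarrow> 'n set set \<Rightarrow> ('n set \<Rightarrow> real) \<Rightarrow> real ^ 'n \<Rightarrow> 'n \<Rightarrow> real" where
  "ext_flow E F I r i = (avg_curvature E F - ext_curvature F I r i) * r $ i"

definition ext_log_flow ::
  "'n::finite set set \<Rightarrow> 'n set set \<Rightarrow> ('n set \<Rightarrow> real) \<Rightarrow> real ^ 'n \<Rightarrow> 'n \<Rightarrow> real" where
  "ext_log_flow E F I u i = avg_curvature E F - ext_curvature F I (exp_vec u) i"


lemma angle_at_cos_law:
  assumes "dist q s = a" "dist p q = b" "dist p s = c"
  shows "angle_at p q s = arccos ((b\<^sup>2 + c\<^sup>2 - a\<^sup>2) / (2 * b * c))"
proof -
  have "a = norm ((q - p) - (s - p))" "b = norm (q - p)" "c = norm (s - p)"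
    using assms by (simp_all add: dist_norm norm_minus_commute)
  then show ?thesis
    unfolding angle_at_def by (simp add: dot_norm_neg mult.assoc)
qed

lemma triangle_angle_cos_law:
  assumes "strict_triangle a b c"
  shows "triangle_angle a b c = arccos ((b\<^sup>2 + c\<^sup>2 - a\<^sup>2) / (2 * b * c))"
proof -
  have pos: "a > 0" "b > 0" "c > 0"
    using assms by (auto simp: strict_triangle_def)
  define x where "x = (b\<^sup>2 + c\<^sup>2 - a\<^sup>2) / (2 * b)"
  have bx: "2 * b * x = b\<^sup>2 + c\<^sup>2 - a\<^sup>2"
    using pos by (simp add: x_def)
  have "\<bar>b - c\<bar> \<le> a" using assms by (auto simp: strict_triangle_def)
  then have "(b - c)\<^sup>2 \<le> a\<^sup>2" using pos by (simp add: abs_le_square_iff[symmetric])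
  then have "2 * b * x \<le> 2 * b * c"
    unfolding bx by (simp add: power2_eq_square algebra_simps)
  then have "x \<le> c" using pos by simp
  have "a\<^sup>2 \<le> (b + c)\<^sup>2"
    using assms pos by (intro power_mono) (auto simp: strict_triangle_def)
  then have "2 * b * (- c) \<le> 2 * b * x"
    unfolding bx by (simp add: power2_eq_square algebra_simps)
  then have "- c \<le> x" using pos by (subst (asm) mult_le_cancel_left_pos) auto
  with \<open>x \<le> c\<close> have "x\<^sup>2 \<le> c\<^sup>2"
    using pos by (simp add: abs_le_square_iff[symmetric] abs_le_iff)
  define y where "y = sqrt (c\<^sup>2 - x\<^sup>2)"
  have y2: "y\<^sup>2 = c\<^sup>2 - x\<^sup>2" using \<open>x\<^sup>2 \<le> c\<^sup>2\<close> by (simp add: y_def)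
  have "dist (vector [b, 0]) (vector [x, y] :: real ^ 2) = sqrt (a\<^sup>2)"
    unfolding dist_norm norm_eq_sqrt_inner
    by (rule arg_cong[of _ _ sqrt])
      (use y2 bx in \<open>simp add: inner_vec_def UNIV_2 power2_eq_square algebra_simps\<close>)
  moreover have "dist 0 (vector [b, 0] :: real ^ 2) = sqrt (b\<^sup>2)"
    unfolding dist_norm norm_eq_sqrt_inner
    by (simp add: inner_vec_def UNIV_2 power2_eq_square)
  moreover have "dist 0 (vector [x, y] :: real ^ 2) = sqrt (c\<^sup>2)"
    unfolding dist_norm norm_eq_sqrt_inner
    using y2 by (simp add: inner_vec_def UNIV_2 power2_eq_square)
  ultimately have "\<exists>p q s :: real ^ 2. dist q s = a \<and> dist p q = b \<and> dist p s = c"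
    using pos by (metis abs_of_pos real_sqrt_abs)
  then show ?thesis
    unfolding triangle_angle_def
    by (intro the_equality) (metis angle_at_cos_law, metis angle_at_cos_law)
qed

lemma strict_triangle_commute: "strict_triangle a b c = strict_triangle a c b"
  by (auto simp: strict_triangle_def)

lemma triangle_angle_commute: "triangle_angle a b c = triangle_angle a c b"
proof -
  have "angle_at p q s = angle_at p s q" for p q s
    by (simp add: angle_at_def inner_commute mult.commute)
  then show ?thesis
    unfolding triangle_angle_def by (intro arg_cong[of _ _ The] ext) (metis dist_commute)
qed

lemma gen_triangle_angle_commute: "gen_triangle_angle a b c = gen_triangle_angle a c b"
  by (simp add: gen_triangle_angle_def strict_triangle_commute[of a b]
      triangle_angle_commute[of a b] add.commute)

lemma edge_length_commute: "edge_length I r i j = edge_length I r j i"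
  by (simp add: edge_length_def insert_commute algebra_simps)

lemma face_angle_eq:
  assumes "card {i, j, k} = 3" and "\<And>a b c. A a b c = A a c b"
  shows "face_angle A I r i {i, j, k} =
    A (edge_length I r j k) (edge_length I r i j) (edge_length I r i k)"
proof -
  define p where "p = (SOME (j', k'). {i, j, k} = {i, j', k'})"
  obtain j' k' where p: "p = (j', k')" by fastforce
  have "case p of (j', k') \<Rightarrow> {i, j, k} = {i, j', k'}"
    unfolding p_def by (rule someI[where x = "(j, k)"]) simp
  then have eq: "{i, j, k} = {i, j', k'}" by (simp add: p)
  have ne: "i \<noteq> j" "i \<noteq> k" "j \<noteq> k"
    using assms(1) by (auto simp: card_insert_if split: if_splits)
  have ne': "i \<noteq> j'" "i \<noteq> k'" "j' \<noteq> k'"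
    using assms(1) unfolding eq by (auto simp: card_insert_if split: if_splits)
  have "j' = j \<and> k' = k \<or> j' = k \<and> k' = j"
    using eq ne ne' by (metis insertE insertI1 insert_commute singletonD)
  then show ?thesis
    unfolding face_angle_def p_def[symmetric] p
    by (auto simp: assms(2) edge_length_commute[of I r k j]
        intro: assms(2))
qed

end

theory Submission
  imports Defs "HOL-Complex_Analysis.Great_Picard"
begin

text \<open>
  In the coordinates \<open>u = ln r\<close> the extended flow is \<open>u' = v u\<close> for a vector field \<open>v\<close> on all of
  \<open>\<real>\<^sup>N\<close> that is bounded and continuous; the arc cosine has vertical tangents at degenerate
  triangles, so solutions come from Peano's theorem. The field is bounded because each
  generalized angle lies between \<open>0\<close> and \<open>\<pi>\<close>. It is continuous because a generalized angle is
  the arc cosine of the law-of-cosines quotient truncated to the interval from \<open>-1\<close> to \<open>1\<close>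
  (\<open>gen_triangle_angle_eq_arccos\<close>), and the edge lengths, continuous in \<open>u\<close>, never vanish
  when \<open>I \<ge> 0\<close>.

  For such a field a solution on \<open>{0..<T}\<close> is Lipschitz, so it converges as \<open>t\<close> tends to a finite \<open>T\<close>;
  \<open>peano_global\<close> continues it from the limit point, and boundedness makes
  the continuation exist for all time (\<open>solution_extends_globally\<close>). On \<open>Omega\<close> the extended and
  the original curvature agree, so this applies to \<open>u = ln r\<close> for the given flow \<open>r\<close>, and \<open>exp u\<close>
  is the extension of \<open>r\<close> in the positive orthant.
\<close>

section \<open>Integral curves of a bounded continuous vector field\<close>

lemma lipschitz_integral:
  fixes f :: "real \<Rightarrow> 'a::euclidean_space"
  assumes cont: "continuous_on UNIV f" and bound: "\<And>s. norm (f s) \<le> C"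
  shows "C-lipschitz_on UNIV (\<lambda>t. x0 + integral {0..t} f)"
proof -
  have "0 \<le> C" using bound[of 0] norm_ge_zero order_trans by blast
  have eq: "integral {0..t} f = integral {0..max 0 t} f" for t
    by (cases "t < 0") (auto simp: max_def)
  have int: "f integrable_on {a..b}" for a b
    by (rule integrable_continuous_real) (rule continuous_on_subset[OF cont], simp)
  show ?thesis
  proof (rule lipschitz_on_leI)
    fix s t :: real
    assume "s \<le> t"
    let ?s = "max 0 s" and ?t = "max 0 t"
    have "integral {0..?s} f + integral {?s..?t} f = integral {0..?t} f"
      by (rule Henstock_Kurzweil_Integration.integral_combine) (use \<open>s \<le> t\<close> int in auto)
    then have "norm (integral {0..?t} f - integral {0..?s} f) = norm (integral {?s..?t} f)"
      by (metis add_diff_cancel_left')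
    also have "\<dots> \<le> C * (?t - ?s)"
      by (rule integral_bound) (use \<open>s \<le> t\<close> bound continuous_on_subset[OF cont] in auto)
    also have "\<dots> \<le> C * dist s t"
      using \<open>0 \<le> C\<close> \<open>s \<le> t\<close> by (intro mult_left_mono) (auto simp: dist_real_def)
    finally show "dist (x0 + integral {0..s} f) (x0 + integral {0..t} f) \<le> C * dist s t"
      unfolding eq[of s] eq[of t] by (simp add: dist_norm norm_minus_commute)
  qed fact
qed

lemma continuous_retarded:
  fixes h :: real
  assumes "continuous_on UNIV v" "continuous_on UNIV x"
  shows "continuous_on UNIV (\<lambda>s. v (x (s - h)))"
proof -
  have "continuous_on UNIV (\<lambda>s. x (s - h))"
    by (rule continuous_on_compose2[OF assms(2)]) (auto intro: continuous_intros)
  then show ?thesis by (rule continuous_on_compose2[OF assms(1)]) auto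
qed

text \<open>
  A retarded equation is solved step by step: on \<open>{..(k + 1) * h}\<close> the right-hand side only involves
  the values on \<open>{..k * h}\<close>, so the Picard iterates become stationary on every half-line.
\<close>

lemma retarded_solution:
  fixes v :: "'a::euclidean_space \<Rightarrow> 'a" and h :: real
  assumes cont: "continuous_on UNIV v" and bound: "\<And>x. norm (v x) \<le> C" and "h > 0"
  obtains x where "C-lipschitz_on UNIV x"
    and "\<And>t. x t = x0 + integral {0..t} (\<lambda>s. v (x (s - h)))"
proof -
  define \<phi> :: "nat \<Rightarrow> real \<Rightarrow> 'a" where
    "\<phi> = rec_nat (\<lambda>t. x0) (\<lambda>k p t. x0 + integral {0..t} (\<lambda>s. v (p (s - h))))"
  have \<phi>0: "\<phi> 0 t = x0" for t by (simp add: \<phi>_def)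
  have \<phi>Suc: "\<phi> (Suc k) t = x0 + integral {0..t} (\<lambda>s. v (\<phi> k (s - h)))" for k t
    by (simp add: \<phi>_def)
  have stationary_Suc: "\<phi> (Suc k) t = \<phi> k t" if "t \<le> real k * h" for k t
    using that
  proof (induction k arbitrary: t)
    case 0
    then show ?case by (cases "t = 0") (auto simp: \<phi>Suc \<phi>0)
  next
    case (Suc k)
    have "integral {0..t} (\<lambda>s. v (\<phi> (Suc k) (s - h))) = integral {0..t} (\<lambda>s. v (\<phi> k (s - h)))"
      by (rule Henstock_Kurzweil_Integration.integral_cong, subst Suc.IH)
        (use Suc.prems in \<open>auto simp: algebra_simps\<close>)
    then show ?case by (simp only: \<phi>Suc[of "Suc k" t] \<phi>Suc[of k t])
  qed
  have stationary: "\<phi> m t = \<phi> k t" if "k \<le> m" "t \<le> real k * h" for k m t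
    using that(1)
  proof (induction m rule: dec_induct)
    case (step m)
    have "t \<le> real m * h"
      by (rule order_trans[OF that(2)]) (use step \<open>h > 0\<close> in \<open>simp add: mult_right_mono\<close>)
    then show ?case using step stationary_Suc by simp
  qed simp
  define x where "x t = \<phi> (nat \<lceil>t / h\<rceil>) t" for t
  have x: "x t = \<phi> k t" if "t \<le> real k * h" for t k
  proof -
    have "t / h \<le> real k" using that \<open>h > 0\<close> by (simp add: divide_le_eq)
    then have "nat \<lceil>t / h\<rceil> \<le> k" by linarith
    moreover have "t / h \<le> real (nat \<lceil>t / h\<rceil>)" by (rule real_nat_ceiling_ge)
    then have "t \<le> real (nat \<lceil>t / h\<rceil>) * h" using \<open>h > 0\<close> by (simp add: divide_le_eq)
    ultimately show ?thesis unfolding x_def by (metis stationary)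
  qed
  have lip: "C-lipschitz_on UNIV (\<phi> k)" for k
  proof (induction k)
    case 0
    have "0 \<le> C" using bound[of 0] norm_ge_zero order_trans by blast
    then show ?case by (intro lipschitz_onI) (auto simp: \<phi>0)
  next
    case (Suc k)
    have "continuous_on UNIV (\<phi> k)" by (rule lipschitz_on_continuous_on[OF Suc])
    then have "continuous_on UNIV (\<lambda>s. v (\<phi> k (s - h)))"
      by (rule continuous_retarded[OF cont])
    from lipschitz_integral[OF this bound, of x0]
    show ?case by (simp add: \<phi>Suc[abs_def])
  qed
  show thesis
  proof
    show "C-lipschitz_on UNIV x"
    proof (rule lipschitz_on_leI)
      fix s t :: real
      assume "s \<le> t"
      obtain k :: nat where "t / h \<le> real k" using real_arch_simple by blast
      then have "t \<le> real k * h" using \<open>h > 0\<close> by (simp add: divide_le_eq)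
      with \<open>s \<le> t\<close> show "dist (x s) (x t) \<le> C * dist s t"
        using x[of s k] x[of t k] lipschitz_onD[OF lip[of k]] by simp
    qed (use lip lipschitz_on_nonneg in blast)
  next
    fix t
    obtain k :: nat where "t / h \<le> real k" using real_arch_simple by blast
    then have k: "t \<le> real k * h" using \<open>h > 0\<close> by (simp add: divide_le_eq)
    then have "x t = \<phi> (Suc k) t" using stationary_Suc[OF k] x[OF k] by simp
    also have "integral {0..t} (\<lambda>s. v (\<phi> k (s - h))) = integral {0..t} (\<lambda>s. v (x (s - h)))"
      by (rule Henstock_Kurzweil_Integration.integral_cong, subst x[of _ k])
        (use k \<open>h > 0\<close> in auto)
    then have "\<phi> (Suc k) t = x0 + integral {0..t} (\<lambda>s. v (x (s - h)))"
      by (simp add: \<phi>Suc)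
    finally show "x t = x0 + integral {0..t} (\<lambda>s. v (x (s - h)))" .
  qed
qed

text \<open>
  The common Lipschitz constant reduces convergence at every time to convergence at rational times,
  where a diagonal argument applies. The time axis need not be compact, because only pointwise
  convergence is claimed.
\<close>

lemma equi_lipschitz_convergent_subsequence:
  fixes X :: "nat \<Rightarrow> real \<Rightarrow> 'a::euclidean_space"
  assumes lip: "\<And>n. C-lipschitz_on UNIV (X n)" and start: "\<And>n. X n 0 = x0"
  obtains k :: "nat \<Rightarrow> nat" and y
  where "strict_mono k" "\<And>t. (\<lambda>n. X (k n) t) \<longlonglongrightarrow> y t"
proof -
  have "0 \<le> C" using lip lipschitz_on_nonneg by blast
  have lipD: "norm (X n s - X n t) \<le> C * \<bar>s - t\<bar>" for n s t
    using lipschitz_onD[OF lip, of s t n] by (simp add: dist_norm)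
  \<comment> \<open>The weight makes the sequence bounded uniformly in time.\<close>
  define f where "f n q = (1 / (1 + \<bar>q\<bar>)) *\<^sub>R (X n q - x0)" for n q
  have "norm (f n q) \<le> C" for n q
  proof -
    have "norm (X n q - x0) \<le> C * (1 + \<bar>q\<bar>)"
      using lipD[of n q 0] start[of n] \<open>0 \<le> C\<close> by (simp add: algebra_simps)
    then show ?thesis by (simp add: f_def divide_le_eq)
  qed
  then obtain k :: "nat \<Rightarrow> nat" where k: "strict_mono k"
    and conv: "\<And>q. q \<in> \<rat> \<Longrightarrow> \<exists>l. (\<lambda>n. f (k n) q) \<longlonglongrightarrow> l"
    using function_convergent_subsequence[of "\<rat> :: real set" f C] countable_rat by blast
  have convq: "Cauchy (\<lambda>n. X (k n) q)" if q: "q \<in> \<rat>" for q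
  proof -
    obtain l where "(\<lambda>n. f (k n) q) \<longlonglongrightarrow> l" using conv[OF q] by blast
    then have "(\<lambda>n. x0 + (1 + \<bar>q\<bar>) *\<^sub>R f (k n) q) \<longlonglongrightarrow> x0 + (1 + \<bar>q\<bar>) *\<^sub>R l"
      by (intro tendsto_intros)
    moreover have "x0 + (1 + \<bar>q\<bar>) *\<^sub>R f (k n) q = X (k n) q" for n
      using abs_ge_zero[of q] by (simp add: f_def add_nonneg_eq_0_iff)
    ultimately show ?thesis by (simp only: LIMSEQ_imp_Cauchy)
  qed
  have "convergent (\<lambda>n. X (k n) t)" for t
  proof (rule Cauchy_convergent, rule metric_CauchyI)
    fix e :: real
    assume "e > 0"
    then have "t < t + e / (3 * (C + 1))" using \<open>0 \<le> C\<close> by simp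
    then obtain q where q: "q \<in> \<rat>" "t < q" "q < t + e / (3 * (C + 1))"
      using Rats_dense_in_real by blast
    have "C * \<bar>q - t\<bar> \<le> (C + 1) * (e / (3 * (C + 1)))"
      using q \<open>0 \<le> C\<close> by (intro mult_mono) auto
    also have "\<dots> = e / 3" using \<open>0 \<le> C\<close> by (simp add: field_simps)
    finally have close: "C * \<bar>q - t\<bar> \<le> e / 3" .
    obtain N where N: "\<And>m n. m \<ge> N \<Longrightarrow> n \<ge> N \<Longrightarrow> dist (X (k m) q) (X (k n) q) < e / 3"
      using metric_CauchyD[OF convq[OF q(1)], of "e / 3"] \<open>e > 0\<close> by auto
    have "dist (X (k m) t) (X (k n) t) < e" if "m \<ge> N" "n \<ge> N" for m n
    proof -
      have "dist (X (k m) t) (X (k n) t)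
          \<le> dist (X (k m) t) (X (k m) q) + dist (X (k m) q) (X (k n) q) + dist (X (k n) q) (X (k n) t)"
        by metric
      moreover have "dist (X (k m) t) (X (k m) q) \<le> e / 3" "dist (X (k n) q) (X (k n) t) \<le> e / 3"
        using lipD[of "k m" q t] lipD[of "k n" q t] close
        by (auto simp: dist_norm norm_minus_commute)
      ultimately show ?thesis using N[OF that] by linarith
    qed
    then show "\<exists>N. \<forall>m\<ge>N. \<forall>n\<ge>N. dist (X (k m) t) (X (k n) t) < e" by blast
  qed
  then have "(\<lambda>n. X (k n) t) \<longlonglongrightarrow> lim (\<lambda>n. X (k n) t)" for t
    by (simp add: convergent_LIMSEQ_iff)
  with k show thesis by (rule that)
qed

text \<open>
  Peano's theorem, global in time because the field is bounded: a limit of solutions of the equations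
  retarded by \<open>1 / (n + 1)\<close> solves the integral equation, by dominated convergence.
\<close>

lemma peano_global:
  fixes v :: "'a::euclidean_space \<Rightarrow> 'a"
  assumes cont: "continuous_on UNIV v" and bound: "\<And>x. norm (v x) \<le> C"
  obtains y :: "real \<Rightarrow> 'a" where "C-lipschitz_on UNIV y"
    and "\<And>t. y t = x0 + integral {0..t} (\<lambda>s. v (y s))"
proof -
  let ?h = "\<lambda>n. inverse (real (Suc n))"
  have "\<exists>x. C-lipschitz_on UNIV x \<and> (\<forall>t. x t = x0 + integral {0..t} (\<lambda>s. v (x (s - ?h n))))" for n
    by (rule retarded_solution[OF cont bound, of "?h n" x0]) (simp, blast)
  then obtain X :: "nat \<Rightarrow> real \<Rightarrow> 'a" where lip: "\<And>n. C-lipschitz_on UNIV (X n)"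
    and X: "\<And>n t. X n t = x0 + integral {0..t} (\<lambda>s. v (X n (s - ?h n)))"
    by metis
  have start: "X n 0 = x0" for n by (subst X) simp
  obtain k y where k: "strict_mono k" and lim: "\<And>t. (\<lambda>n. X (k n) t) \<longlonglongrightarrow> y t"
    using equi_lipschitz_convergent_subsequence[of C X x0, OF lip start] by blast
  have "0 \<le> C" using lip lipschitz_on_nonneg by blast
  have hk: "(\<lambda>n. ?h (k n)) \<longlonglongrightarrow> 0"
    using LIMSEQ_subseq_LIMSEQ[OF LIMSEQ_inverse_real_of_nat k] by (simp add: o_def)
  have lim': "(\<lambda>n. v (X (k n) (s - ?h (k n)))) \<longlonglongrightarrow> v (y s)" for s
  proof -
    have "(\<lambda>n. X (k n) (s - ?h (k n)) - X (k n) s) \<longlonglongrightarrow> 0"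
    proof (rule Lim_null_comparison)
      show "\<forall>\<^sub>F n in sequentially. norm (X (k n) (s - ?h (k n)) - X (k n) s) \<le> C * ?h (k n)"
      proof (intro always_eventually allI)
        show "norm (X (k n) (s - ?h (k n)) - X (k n) s) \<le> C * ?h (k n)" for n
          using lipschitz_onD[OF lip, of "s - ?h (k n)" s "k n"] by (simp add: dist_norm)
      qed
      show "(\<lambda>n. C * ?h (k n)) \<longlonglongrightarrow> 0" using tendsto_mult_right_zero[OF hk] .
    qed
    from tendsto_add[OF this lim[of s]]
    have "(\<lambda>n. X (k n) (s - ?h (k n))) \<longlonglongrightarrow> y s" by simp
    then show ?thesis by (rule continuous_on_tendsto_compose[OF cont]) auto
  qed
  show thesis
  proof
    show "C-lipschitz_on UNIV y"
    proof (rule lipschitz_onI)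
      fix s t
      have "(\<lambda>n. dist (X (k n) s) (X (k n) t)) \<longlonglongrightarrow> dist (y s) (y t)"
        by (intro tendsto_dist lim)
      then show "dist (y s) (y t) \<le> C * dist s t"
        by (rule LIMSEQ_le_const2) (use lipschitz_onD[OF lip] in auto)
    qed fact
  next
    fix t
    have "continuous_on UNIV (\<lambda>s. v (X (k n) (s - ?h (k n))))" for n
      by (rule continuous_retarded[OF cont lipschitz_on_continuous_on[OF lip]])
    then have int: "(\<lambda>s. v (X (k n) (s - ?h (k n)))) integrable_on {0..t}" for n
      by (intro integrable_continuous_real) (rule continuous_on_subset, auto)
    have "(\<lambda>n. integral {0..t} (\<lambda>s. v (X (k n) (s - ?h (k n)))))
        \<longlonglongrightarrow> integral {0..t} (\<lambda>s. v (y s))"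
      by (rule dominated_convergence(2)[OF int, where h = "\<lambda>_. C"]) (use bound lim' in auto)
    then have "(\<lambda>n. X (k n) t) \<longlonglongrightarrow> x0 + integral {0..t} (\<lambda>s. v (y s))"
      by (subst X) (intro tendsto_intros)
    then show "y t = x0 + integral {0..t} (\<lambda>s. v (y s))"
      using lim LIMSEQ_unique by blast
  qed
qed

lemma integral_equation_imp_derivative:
  fixes v :: "'a::euclidean_space \<Rightarrow> 'a" and y :: "real \<Rightarrow> 'a"
  assumes cont: "continuous_on UNIV v" and y: "continuous_on {0..} y"
    and eq: "\<And>t. t \<ge> 0 \<Longrightarrow> y t = x0 + integral {0..t} (\<lambda>s. v (y s))" and "t \<ge> 0"
  shows "(y has_vector_derivative v (y t)) (at t within {0..})"
proof -
  have "continuous_on {0..t + 1} (\<lambda>s. v (y s))"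
    by (rule continuous_on_compose2[OF cont continuous_on_subset[OF y]]) auto
  then have "((\<lambda>t. integral {0..t} (\<lambda>s. v (y s))) has_vector_derivative v (y t))
      (at t within {0..t + 1})"
    by (rule integral_has_vector_derivative) (use \<open>t \<ge> 0\<close> in auto)
  then have "((\<lambda>t. x0 + integral {0..t} (\<lambda>s. v (y s))) has_vector_derivative v (y t))
      (at t within {0..t + 1})"
    by (auto intro!: derivative_eq_intros)
  then have "(y has_vector_derivative v (y t)) (at t within {0..t + 1})"
  proof (rule has_vector_derivative_transform[rotated 2])
    show "y s = x0 + integral {0..s} (\<lambda>s. v (y s))" if "s \<in> {0..t + 1}" for s
      using that by (intro eq) simp
  qed (use \<open>t \<ge> 0\<close> in simp)
  moreover have "at t within {0..t + 1} = at t within {0..}"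
    by (rule at_within_nhd[of t "{..<t + 1}"]) auto
  ultimately show ?thesis by simp
qed

text \<open>
  A bounded velocity makes a solution on \<open>{0..<\<tau>}\<close> Lipschitz, so it has a limit at \<open>\<tau>\<close>, from which
  a global solution starts. The junction is harmless: the integral equation tolerates one
  exceptional time in the fundamental theorem of calculus and then yields the derivative there.
\<close>

lemma solution_extends_globally:
  fixes v :: "'a::euclidean_space \<Rightarrow> 'a"
  assumes cont: "continuous_on UNIV v" and bound: "\<And>x. norm (v x) \<le> C" and "0 < T"
    and sol: "\<And>t. t \<in> time_interval T \<Longrightarrow>
      (x has_vector_derivative v (x t)) (at t within time_interval T)"
  obtains u where "\<And>t. t \<in> time_interval T \<Longrightarrow> u t = x t"
    and "\<And>t. t \<ge> 0 \<Longrightarrow> (u has_vector_derivative v (u t)) (at t within {0..})"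
proof (cases T)
  case PInf
  then have "time_interval T = {0..}" by (auto simp: time_interval_def)
  then show thesis using sol that by auto
next
  case MInf
  then show thesis using \<open>0 < T\<close> by simp
next
  case (real \<tau>)
  then have "\<tau> > 0" and T: "time_interval T = {0..<\<tau>}"
    using \<open>0 < T\<close> by (auto simp: time_interval_def)
  have "0 \<le> C" using bound[of 0] norm_ge_zero order_trans by blast
  have "C-lipschitz_on {0..<\<tau>} x"
  proof (rule bounded_derivative_imp_lipschitz)
    fix t assume "t \<in> {0..<\<tau>}"
    then show "(x has_derivative (\<lambda>h. h *\<^sub>R v (x t))) (at t within {0..<\<tau>})"
      using sol[of t] by (simp add: T has_vector_derivative_def)
    show "onorm (\<lambda>h. h *\<^sub>R v (x t)) \<le> C"
      using bound[of "x t"] by (intro onorm_le) (simp add: mult.commute[of C] mult_left_mono)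
  qed (use \<open>0 \<le> C\<close> in auto)
  then obtain x' where "C-lipschitz_on (closure {0..<\<tau>}) x'" and x': "\<And>t. t \<in> {0..<\<tau>} \<Longrightarrow> x' t = x t"
    using lipschitz_extend_closure by metis
  then have contx': "continuous_on {0..\<tau>} x'"
    using \<open>\<tau> > 0\<close> by (simp add: lipschitz_on_continuous_on)
  obtain y :: "real \<Rightarrow> 'a" where lipy: "C-lipschitz_on UNIV y"
    and y: "\<And>t. y t = x' \<tau> + integral {0..t} (\<lambda>s. v (y s))"
    using peano_global[OF cont bound] by metis
  have y0: "y 0 = x' \<tau>" by (subst y) simp
  have conty: "continuous_on UNIV y" using lipy by (rule lipschitz_on_continuous_on)
  define u where "u t = (if t \<le> \<tau> then x' t else y (t - \<tau>))" for t
  have contu: "continuous_on {0..} u"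
  proof -
    have "continuous_on ({0..\<tau>} \<union> {\<tau>..}) u"
      unfolding u_def
    proof (rule continuous_on_If)
      show "continuous_on {\<tau>..} (\<lambda>t. y (t - \<tau>))"
        by (rule continuous_on_compose2[OF conty]) (auto intro: continuous_intros)
    qed (use contx' y0 in auto)
    moreover have "{0..\<tau>} \<union> {\<tau>..} = {0..}" using \<open>\<tau> > 0\<close> by auto
    ultimately show ?thesis by simp
  qed
  have deriv: "(u has_vector_derivative v (u t)) (at t)" if "t > 0" "t \<noteq> \<tau>" for t
  proof (cases "t < \<tau>")
    case True
    then have "(x has_vector_derivative v (x t)) (at t within {0<..<\<tau>})"
      using sol[of t] \<open>t > 0\<close> unfolding T
      by (auto intro: has_vector_derivative_within_subset)
    then have "(x has_vector_derivative v (u t)) (at t)"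
      using True \<open>t > 0\<close> x'[of t] by (simp add: at_within_open[of t "{0<..<\<tau>}"] u_def)
    then show ?thesis
      by (rule has_vector_derivative_transform_within_open[where S = "{0<..<\<tau>}"])
        (use True \<open>t > 0\<close> x' in \<open>auto simp: u_def\<close>)
  next
    case False
    then have "t > \<tau>" using that by simp
    have "(y has_vector_derivative v (y (t - \<tau>))) (at (t - \<tau>) within {0..})"
      by (rule integral_equation_imp_derivative[OF cont _ y])
        (use \<open>t > \<tau>\<close> continuous_on_subset[OF conty] in auto)
    then have "(y has_vector_derivative v (y (t - \<tau>))) (at (t - \<tau>) within {0<..})"
      by (rule has_vector_derivative_within_subset) auto
    then have "(y has_vector_derivative v (u t)) (at (t - \<tau>))"
      using \<open>t > \<tau>\<close> by (simp add: at_within_open[of "t - \<tau>" "{0<..}"] u_def)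
    then have "((y \<circ> (\<lambda>t. t - \<tau>)) has_vector_derivative 1 *\<^sub>R v (u t)) (at t)"
      by (intro vector_diff_chain_at) (auto intro!: derivative_eq_intros)
    then have "((\<lambda>t. y (t - \<tau>)) has_vector_derivative v (u t)) (at t)"
      by (simp add: o_def)
    then show ?thesis
      by (rule has_vector_derivative_transform_within_open[where S = "{\<tau><..}"])
        (use \<open>t > \<tau>\<close> in \<open>auto simp: u_def\<close>)
  qed
  have integral_eq: "u t = u 0 + integral {0..t} (\<lambda>s. v (u s))" if "t \<ge> 0" for t
  proof -
    have "((\<lambda>s. v (u s)) has_integral (u t - u 0)) {0..t}"
      by (rule fundamental_theorem_of_calculus_interior_strong[of "{\<tau>}"])
        (use \<open>t \<ge> 0\<close> deriv continuous_on_subset[OF contu] in auto)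
    then show ?thesis by (simp add: integral_unique)
  qed
  show thesis
  proof
    show "u t = x t" if "t \<in> time_interval T" for t
      using that x' by (auto simp: T u_def)
    show "(u has_vector_derivative v (u t)) (at t within {0..})" if "t \<ge> 0" for t
      by (rule integral_equation_imp_derivative[OF cont contu integral_eq that])
  qed
qed

section \<open>The extended logarithmic flow is continuous and bounded\<close>

text \<open>
  Truncating the cosine at \<open>1\<close> and \<open>-1\<close> produces exactly the degenerate angles: the law of cosines
  gives a value \<open>\<le> -1\<close> iff \<open>(b + c)\<^sup>2 \<le> a\<^sup>2\<close> and a value \<open>\<ge> 1\<close> iff \<open>a\<^sup>2 \<le> (b - c)\<^sup>2\<close>.
\<close>

lemma gen_triangle_angle_eq_arccos:
  assumes "a > 0" "b > 0" "c > 0"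
  shows "gen_triangle_angle a b c =
    arccos (max (- 1) (min 1 ((b\<^sup>2 + c\<^sup>2 - a\<^sup>2) / (2 * b * c))))"
proof -
  let ?q = "(b\<^sup>2 + c\<^sup>2 - a\<^sup>2) / (2 * b * c)"
  have le: "?q \<le> - 1 \<longleftrightarrow> a \<ge> b + c"
  proof -
    have "?q \<le> - 1 \<longleftrightarrow> (b + c)\<^sup>2 \<le> a\<^sup>2"
      using assms by (simp add: divide_le_eq power2_eq_square algebra_simps)
    also have "\<dots> \<longleftrightarrow> b + c \<le> a" using assms by (simp add: abs_le_square_iff[symmetric])
    finally show ?thesis .
  qed
  have ge: "1 \<le> ?q \<longleftrightarrow> a \<le> \<bar>b - c\<bar>"
  proof -
    have "1 \<le> ?q \<longleftrightarrow> a\<^sup>2 \<le> (b - c)\<^sup>2"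
      using assms by (simp add: le_divide_eq power2_eq_square algebra_simps)
    also have "\<dots> \<longleftrightarrow> a \<le> \<bar>b - c\<bar>" using assms by (simp add: abs_le_square_iff[symmetric])
    finally show ?thesis .
  qed
  consider "strict_triangle a b c" | "a \<ge> b + c" | "a \<le> \<bar>b - c\<bar>"
    unfolding strict_triangle_def by linarith
  then show ?thesis
  proof cases
    case 1
    then have "- 1 < ?q" "?q < 1" using le ge by (auto simp: strict_triangle_def not_le)
    then show ?thesis
      using 1 by (simp add: gen_triangle_angle_def triangle_angle_cos_law)
  next
    case 2
    then have "?q \<le> - 1" using le by simp
    then have "max (- 1) (min 1 ?q) = - 1" by linarith
    then show ?thesis using 2 by (simp add: gen_triangle_angle_def strict_triangle_def)
  next
    case 3
    then have "1 \<le> ?q" using ge by simp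
    then have "max (- 1) (min 1 ?q) = 1" by linarith
    then show ?thesis
      using 3 assms by (auto simp: gen_triangle_angle_def strict_triangle_def)
  qed
qed

lemma gen_triangle_angle_bounds:
  assumes "a > 0" "b > 0" "c > 0"
  shows "\<bar>gen_triangle_angle a b c\<bar> \<le> pi"
proof -
  have "- 1 \<le> max (- 1) (min 1 q)" "max (- 1) (min 1 q) \<le> 1" for q :: real by auto
  then show ?thesis
    using assms by (simp add: gen_triangle_angle_eq_arccos arccos_lbound arccos_ubound)
qed

lemma edge_length_exp_vec_pos:
  assumes "I {i, j} \<ge> 0"
  shows "edge_length I (exp_vec u) i j > 0"
  using assms by (simp add: edge_length_def exp_vec_def add_pos_nonneg)

lemma continuous_edge_length_exp_vec:
  "continuous_on UNIV (\<lambda>u. edge_length I (exp_vec u) i j)"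
  unfolding edge_length_def exp_vec_def by (auto intro!: continuous_intros)

lemma face_obtain:
  assumes "triangulation_of M E F" "f \<in> F" "i \<in> f"
  obtains j k where "f = {i, j, k}" "card {i, j, k} = 3" "{j, k} \<in> E" "{i, j} \<in> E" "{i, k} \<in> E"
proof -
  have "card f = 3" and edges: "\<And>e. e \<subseteq> f \<Longrightarrow> card e = 2 \<Longrightarrow> e \<in> E"
    using assms by (auto simp: triangulation_of_def)
  then have "card (f - {i}) = 2" using \<open>i \<in> f\<close> by simp
  then obtain j k where "f - {i} = {j, k}" "j \<noteq> k" by (meson card_2_iff)
  then have "f = {i, j, k}" "i \<noteq> j" "i \<noteq> k" using \<open>i \<in> f\<close> by auto
  with \<open>card f = 3\<close> \<open>j \<noteq> k\<close> show thesis by (intro that) (auto intro!: edges)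
qed

lemma face_angle_gen_exp_vec:
  assumes tri: "triangulation_of M E F" and I: "\<forall>e\<in>E. I e \<ge> 0" and f: "f \<in> F" "i \<in> f"
  shows "continuous_on UNIV (\<lambda>u. face_angle gen_triangle_angle I (exp_vec u) i f)"
    and "\<bar>face_angle gen_triangle_angle I (exp_vec u) i f\<bar> \<le> pi"
proof -
  obtain j k where f: "f = {i, j, k}" "card {i, j, k} = 3"
    and E: "{j, k} \<in> E" "{i, j} \<in> E" "{i, k} \<in> E"
    using face_obtain[OF tri f] by metis
  let ?a = "\<lambda>u. edge_length I (exp_vec u) j k"
    and ?b = "\<lambda>u. edge_length I (exp_vec u) i j" and ?c = "\<lambda>u. edge_length I (exp_vec u) i k"
  have pos: "?a u > 0" "?b u > 0" "?c u > 0" for u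
    using E I by (auto intro!: edge_length_exp_vec_pos)
  have eq: "face_angle gen_triangle_angle I (exp_vec u) i f = gen_triangle_angle (?a u) (?b u) (?c u)"
    for u
    unfolding f(1) by (rule face_angle_eq[OF f(2) gen_triangle_angle_commute])
  show "\<bar>face_angle gen_triangle_angle I (exp_vec u) i f\<bar> \<le> pi"
    unfolding eq by (rule gen_triangle_angle_bounds) (rule pos)+
  show "continuous_on UNIV (\<lambda>u. face_angle gen_triangle_angle I (exp_vec u) i f)"
    unfolding eq gen_triangle_angle_eq_arccos[OF pos]
    by (intro continuous_intros continuous_edge_length_exp_vec)
      (use pos in \<open>auto simp: less_imp_neq[symmetric] min_le_iff_disj le_max_iff_disj\<close>)
qed

lemma ext_log_flow_continuous:
  assumes "triangulation_of M E F" "\<forall>e\<in>E. I e \<ge> 0"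
  shows "continuous_on UNIV (\<lambda>u. ext_log_flow E F I u i)"
  unfolding ext_log_flow_def ext_curvature_def
  by (intro continuous_intros face_angle_gen_exp_vec(1)[OF assms]) auto

lemma ext_log_flow_bounded:
  fixes E F :: "'n::finite set set"
  assumes "triangulation_of M E F" "\<forall>e\<in>E. I e \<ge> 0"
  shows "\<bar>ext_log_flow E F I u i\<bar> \<le> \<bar>avg_curvature E F\<bar> + 2 * pi + real (card F) * pi"
proof -
  let ?S = "\<Sum>f | f \<in> F \<and> i \<in> f. face_angle gen_triangle_angle I (exp_vec u) i f"
  have "\<bar>?S\<bar> \<le> (\<Sum>f | f \<in> F \<and> i \<in> f. \<bar>face_angle gen_triangle_angle I (exp_vec u) i f\<bar>)"
    by (rule sum_abs)
  also have "\<dots> \<le> (\<Sum>f | f \<in> F \<and> i \<in> f. pi)"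
    by (intro sum_mono face_angle_gen_exp_vec(2)[OF assms]) auto
  also have "\<dots> = real (card {f. f \<in> F \<and> i \<in> f}) * pi" by simp
  also have "\<dots> \<le> real (card F) * pi"
    by (intro mult_right_mono) (auto intro!: card_mono)
  finally show ?thesis
    using pi_gt_zero unfolding ext_log_flow_def ext_curvature_def by linarith
qed

section \<open>Logarithmic coordinates\<close>

lemma exp_vec_ln_vec: "r \<in> pos_orthant \<Longrightarrow> exp_vec (ln_vec r) = r"
  by (simp add: exp_vec_def ln_vec_def pos_orthant_def vec_eq_iff)

lemma ext_curvature_eq_curvature:
  assumes tri: "triangulation_of M E F" and r: "r \<in> Omega F I"
  shows "ext_curvature F I r i = curvature F I r i"
proof -
  have "face_angle gen_triangle_angle I r i f = face_angle triangle_angle I r i f"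
    if f: "f \<in> F" "i \<in> f" for f
  proof -
    obtain j k where fjk: "f = {i, j, k}" "card {i, j, k} = 3"
      using face_obtain[OF tri f] by metis
    then have "strict_triangle (edge_length I r i j) (edge_length I r j k) (edge_length I r i k)"
      using r f(1) unfolding Omega_def by blast
    then have "strict_triangle (edge_length I r j k) (edge_length I r i j) (edge_length I r i k)"
      unfolding strict_triangle_def by linarith
    then show ?thesis
      unfolding fjk(1) face_angle_eq[OF fjk(2) gen_triangle_angle_commute]
        face_angle_eq[OF fjk(2) triangle_angle_commute]
      by (simp add: gen_triangle_angle_def)
  qed
  then show ?thesis unfolding ext_curvature_def curvature_def by (auto intro!: sum.cong)
qed

lemma has_vector_derivative_vec:
  fixes u :: "real \<Rightarrow> real ^ 'n::finite"
  shows "(u has_vector_derivative d) (at t within S) \<longleftrightarrow>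
    (\<forall>i. ((\<lambda>s. u s $ i) has_real_derivative d $ i) (at t within S))"
  unfolding has_vector_derivative_def has_field_derivative_def
  by (subst has_derivative_componentwise_within)
    (simp add: Basis_vec_def inner_axis mult_commute_abs)

theorem theorem2p2:
  fixes M :: "'m topology"
    and E F :: "'n::finite set set"
    and I :: "'n set \<Rightarrow> real"
    and T :: ereal
    and r :: "real \<Rightarrow> real ^ 'n"
  assumes "closed_surface M"
    and "triangulation_of M E F"
    and "\<forall>e\<in>E. I e \<ge> 0"
    and "0 < T"
    and "r 0 \<in> Omega F I"
    and "unique_maximal_solution_in (Omega F I) (normalized_flow E F I) T r"
  shows "(T < \<infinity> \<longrightarrow>
           (\<exists>R. (\<forall>t\<in>time_interval T. R t = r t) \<and>
                solution_in pos_orthant (ext_flow E F I) \<infinity> R)) \<and>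
         (\<exists>u. u 0 = ln_vec (r 0) \<and> u 0 \<in> ln_Omega F I \<and>
              (\<forall>t\<in>time_interval T. u t = ln_vec (r t)) \<and>
              solution_in UNIV (ext_log_flow E F I) \<infinity> u)"
proof -
  note tri = assms(2) and I = assms(3)
  have interval: "time_interval \<infinity> = {0..}" and zero: "0 \<in> time_interval T"
    using \<open>0 < T\<close> by (auto simp: time_interval_def zero_ereal_def)
  have "solution_in (Omega F I) (normalized_flow E F I) T r"
    using assms(6) unfolding unique_maximal_solution_in_def by blast
  then have r: "r t \<in> Omega F I"
    and r': "((\<lambda>s. r s $ i) has_real_derivative normalized_flow E F I (r t) i)
      (at t within time_interval T)" if "t \<in> time_interval T" for t i
    using that unfolding solution_in_def by blast+
  have pos: "r t \<in> pos_orthant" if "t \<in> time_interval T" for t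
    using r[OF that] by (simp add: Omega_def)
  define v where "v u = (\<chi> i. ext_log_flow E F I u i)" for u
  define B where "B = \<bar>avg_curvature E F\<bar> + 2 * pi + real (card F) * pi"
  have v_cont: "continuous_on UNIV v"
    unfolding v_def by (intro continuous_on_vec_lambda ext_log_flow_continuous[OF tri I])
  have v_bound: "norm (v u) \<le> real CARD('n) * B" for u
  proof -
    have "norm (v u) \<le> (\<Sum>i\<in>UNIV. \<bar>v u $ i\<bar>)" by (rule norm_le_l1_cart)
    also have "\<dots> \<le> (\<Sum>i\<in>(UNIV :: 'n set). B)"
      using ext_log_flow_bounded[OF tri I] by (intro sum_mono) (simp add: v_def B_def)
    finally show ?thesis by simp
  qed
  have ln_r': "((\<lambda>t. ln_vec (r t)) has_vector_derivative v (ln_vec (r t)))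
      (at t within time_interval T)" if t: "t \<in> time_interval T" for t
    unfolding has_vector_derivative_vec
  proof
    fix i
    have "r t $ i > 0" using pos[OF t] by (simp add: pos_orthant_def)
    then have "((\<lambda>s. ln (r s $ i)) has_real_derivative normalized_flow E F I (r t) i / r t $ i)
        (at t within time_interval T)"
      using r'[OF t] by (auto intro!: derivative_eq_intros)
    moreover have "normalized_flow E F I (r t) i / r t $ i = v (ln_vec (r t)) $ i"
      using \<open>r t $ i > 0\<close> ext_curvature_eq_curvature[OF tri r[OF t]]
      by (simp add: v_def ext_log_flow_def normalized_flow_def exp_vec_ln_vec[OF pos[OF t]])
    ultimately show "((\<lambda>s. ln_vec (r s) $ i) has_real_derivative v (ln_vec (r t)) $ i)
        (at t within time_interval T)"
      by (simp add: ln_vec_def)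
  qed
  obtain u where u: "\<And>t. t \<in> time_interval T \<Longrightarrow> u t = ln_vec (r t)"
    and u': "\<And>t. t \<ge> 0 \<Longrightarrow> (u has_vector_derivative v (u t)) (at t within {0..})"
    using solution_extends_globally[OF v_cont v_bound \<open>0 < T\<close> ln_r'] by blast
  have u'_comp: "((\<lambda>s. u s $ i) has_real_derivative ext_log_flow E F I (u t) i) (at t within {0..})"
    if "t \<ge> 0" for t i
    using u'[OF that] by (simp add: has_vector_derivative_vec v_def)
  have u_sol: "solution_in UNIV (ext_log_flow E F I) \<infinity> u"
    using u'_comp by (simp add: solution_in_def interval)
  have u_0: "u 0 \<in> ln_Omega F I"
    using u[OF zero] pos[OF zero] \<open>r 0 \<in> Omega F I\<close> by (simp add: ln_Omega_def exp_vec_ln_vec)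
  have exp_u: "exp_vec (u t) = r t" if "t \<in> time_interval T" for t
    using u[OF that] pos[OF that] by (simp add: exp_vec_ln_vec)
  have exp_u_sol: "solution_in pos_orthant (ext_flow E F I) \<infinity> (\<lambda>t. exp_vec (u t))"
    unfolding solution_in_def interval
  proof (intro ballI conjI allI)
    fix t :: real and i
    assume "t \<in> {0..}"
    then have "((\<lambda>s. exp (u s $ i)) has_real_derivative
        exp (u t $ i) * ext_log_flow E F I (u t) i) (at t within {0..})"
      using u'_comp[of t i] by (auto intro!: derivative_eq_intros)
    then show "((\<lambda>s. exp_vec (u s) $ i) has_real_derivative ext_flow E F I (exp_vec (u t)) i)
        (at t within {0..})"
      by (simp add: exp_vec_def ext_flow_def ext_log_flow_def mult.commute)
  qed (simp add: pos_orthant_def exp_vec_def)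
  show ?thesis
  proof (rule conjI; (rule impI)?)
    show "\<exists>R. (\<forall>t\<in>time_interval T. R t = r t) \<and> solution_in pos_orthant (ext_flow E F I) \<infinity> R"
      using exp_u exp_u_sol by (intro exI[of _ "\<lambda>t. exp_vec (u t)"]) simp
    show "\<exists>u. u 0 = ln_vec (r 0) \<and> u 0 \<in> ln_Omega F I \<and>
        (\<forall>t\<in>time_interval T. u t = ln_vec (r t)) \<and> solution_in UNIV (ext_log_flow E F I) \<infinity> u"
      using u zero u_0 u_sol by (intro exI[of _ u]) simp
  qed
qed

end
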